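(* Let $n\ge 1$, let $T=e_1T_1+e_2T_2\in L_1^n\times_eL_1^n$ be a linear operator on $\mathbb{C}_2^n$ (over $\mathbb{C}_1$), and let $\Upsilon_1,\Upsilon_2\subseteq\mathbb{C}_1$ be the sets of all eigenvalues of $T_1$ and $T_2$, respectively. Let $\kappa=\kappa_1e_1+\kappa_2e_2$ (with $\kappa_1,\kappa_2\in\mathbb{C}_1$) be a modified eigenvalue of $T$ such that $\kappa_1\notin\Upsilon_1$ and $\kappa_2\in\Upsilon_2$. Then $${}^T(ME)_\kappa=\{0\}\times_e{}^{T_2}(E)_{\kappa_2}.$$
   Context: $\mathbb{C}_1$ denotes the complex numbers with imaginary unit $i_1$. The bicomplex numbers are $\mathbb{C}_2=\{z_1+i_2z_2 : z_1,z_2\in\mathbb{C}_1\}$, a commutative $\mathbb{C}_1$-algebra with $i_1^2=i_2^2=-1$, $i_1i_2=i_2i_1$. Put $e_1=(1+i_1i_2)/2$ and $e_2=(1-i_1i_2)/2$; these are idempotents with $e_1+e_2=1$, $e_1e_2=0$. Every $\xi=z_1+i_2z_2\in\mathbb{C}_2$ is uniquely $\xi=\xi^-e_1+\xi^+e_2$ with $\xi^-=z_1-i_1z_2$, $\xi^+=z_1+i_1z_2\in\mathbb{C}_1$. $\mathbb{C}_2^n$ is regarded as a vector space over $\mathbb{C}_1$; bicomplex scalars act on it componentwise. $L_1^n$ is the set of $\mathbb{C}_1$-linear operators $\mathbb{C}_1^n\to\mathbb{C}_1^n$. For $T_1,T_2\in L_1^n$, $T=e_1T_1+e_2T_2$ is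 the $\mathbb{C}_1$-linear operator on $\mathbb{C}_2^n$ given by $T(\xi_1,\dots,\xi_n)=e_1T_1(\xi_1^-,\dots,\xi_n^-)+e_2T_2(\xi_1^+,\dots,\xi_n^+)$, and $L_1^n\times_eL_1^n$ is the set of all such operators. A scalar $\kappa\in\mathbb{C}_2$ is a modified eigenvalue of $T$ if there is a nonzero $x\in\mathbb{C}_2^n$ with $T(x)=\kappa x$; its modified eigenspace is ${}^T(ME)_\kappa=\{x\in\mathbb{C}_2^n : T(x)=\kappa x\}$. For an eigenvalue $z$ of $T_j$ ($j=1,2$), ${}^{T_j}(E)_z=\{v\in\mathbb{C}_1^n : T_j(v)=zv\}$. For $S_1,S_2\subseteq\mathbb{C}_1^n$, the idempotent product is $S_1\times_eS_2=\{e_1x+e_2y : x\in S_1,\ y\in S_2\}\subseteq\mathbb{C}_2^n$. *)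

theory Defs
  imports "HOL-Analysis.Analysis"
begin

text \<open>The field of complex numbers with unit \<open>i\<^sub>1\<close> is the library type \<^typ>\<open>complex\<close>;
  \<open>Bicomplex z\<^sub>1 z\<^sub>2\<close> stands for \<open>z\<^sub>1 + i\<^sub>2 z\<^sub>2\<close>.\<close>

datatype bicomplex = Bicomplex (bc1: complex) (bc2: complex)

lemma bicomplex_eq_iff: "x = y \<longleftrightarrow> bc1 x = bc1 y \<and> bc2 x = bc2 y"
  by (cases x; cases y) simp

instantiation bicomplex :: comm_ring_1
begin

definition "0 = Bicomplex 0 0"
definition "1 = Bicomplex 1 0"
definition "x + y = Bicomplex (bc1 x + bc1 y) (bc2 x + bc2 y)"
definition "- x = Bicomplex (- bc1 x) (- bc2 x)"
definition "x - y = Bicomplex (bc1 x - bc1 y) (bc2 x - bc2 y)"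
definition "x * y = Bicomplex (bc1 x * bc1 y - bc2 x * bc2 y) (bc1 x * bc2 y + bc2 x * bc1 y)"

instance
  by standard
    (simp_all add: bicomplex_eq_iff zero_bicomplex_def one_bicomplex_def plus_bicomplex_def
      uminus_bicomplex_def minus_bicomplex_def times_bicomplex_def algebra_simps)

end

definition of_C1 :: "complex \<Rightarrow> bicomplex" where
  "of_C1 z = Bicomplex z 0"

definition bi1 :: bicomplex where "bi1 = of_C1 \<i>"

definition bi2 :: bicomplex where "bi2 = Bicomplex 0 1"

definition be1 :: bicomplex where "be1 = of_C1 (1/2) * (1 + bi1 * bi2)"

definition be2 :: bicomplex where "be2 = of_C1 (1/2) * (1 - bi1 * bi2)"

text \<open>The idempotent components \<open>\<xi>\<^sup>-\<close> and \<open>\<xi>\<^sup>+\<close>; note that \<open>\<xi>\<^sup>-\<close> belongs to \<open>e\<^sub>1\<close>.\<close>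

definition bminus :: "bicomplex \<Rightarrow> complex" where
  "bminus \<xi> = bc1 \<xi> - \<i> * bc2 \<xi>"

definition bplus :: "bicomplex \<Rightarrow> complex" where
  "bplus \<xi> = bc1 \<xi> + \<i> * bc2 \<xi>"

lemmas bicomplex_arith_defs = zero_bicomplex_def one_bicomplex_def plus_bicomplex_def
  uminus_bicomplex_def minus_bicomplex_def times_bicomplex_def of_C1_def

lemma bicomplex_units: "bi1 * bi1 = - 1" "bi2 * bi2 = - 1"
  by (simp_all add: bi1_def bi2_def bicomplex_arith_defs)

lemma Bicomplex_eq: "Bicomplex z1 z2 = of_C1 z1 + bi2 * of_C1 z2"
  by (simp add: bi2_def bicomplex_arith_defs)

lemma be_idempotents: "be1 * be1 = be1" "be2 * be2 = be2" "be1 * be2 = 0" "be1 + be2 = 1"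
  by (simp_all add: be1_def be2_def bi1_def bi2_def bicomplex_arith_defs)

lemma idempotent_decomposition: "\<xi> = of_C1 (bminus \<xi>) * be1 + of_C1 (bplus \<xi>) * be2"
  by (simp add: bicomplex_eq_iff be1_def be2_def bi1_def bi2_def bminus_def bplus_def
      bicomplex_arith_defs field_simps)

lemma idempotent_components:
  "bminus (of_C1 a * be1 + of_C1 b * be2) = a" "bplus (of_C1 a * be1 + of_C1 b * be2) = b"
  by (simp_all add: be1_def be2_def bi1_def bi2_def bminus_def bplus_def
      bicomplex_arith_defs field_simps)

definition vec_of_C1 :: "complex ^ 'n \<Rightarrow> bicomplex ^ 'n" where
  "vec_of_C1 v = (\<chi> i. of_C1 (v $ i))"

definition vminus :: "bicomplex ^ 'n \<Rightarrow> complex ^ 'n" where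
  "vminus x = (\<chi> i. bminus (x $ i))"

definition vplus :: "bicomplex ^ 'n \<Rightarrow> complex ^ 'n" where
  "vplus x = (\<chi> i. bplus (x $ i))"

text \<open>Linearity is over \<^typ>\<open>complex\<close> (the constant \<^term>\<open>linear\<close> would only mean real-linear).\<close>

definition L1 :: "(complex ^ 'n \<Rightarrow> complex ^ 'n) set" where
  "L1 = {T. Vector_Spaces.linear (*s) (*s) T}"

definition idem_op ::
  "(complex ^ 'n \<Rightarrow> complex ^ 'n) \<Rightarrow> (complex ^ 'n \<Rightarrow> complex ^ 'n) \<Rightarrow> bicomplex ^ 'n \<Rightarrow> bicomplex ^ 'n"
  where "idem_op T1 T2 x = be1 *s vec_of_C1 (T1 (vminus x)) + be2 *s vec_of_C1 (T2 (vplus x))"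

definition idem_prod :: "(complex ^ 'n) set \<Rightarrow> (complex ^ 'n) set \<Rightarrow> (bicomplex ^ 'n) set"
  (infixr "\<times>\<^sub>e" 80) where
  "S1 \<times>\<^sub>e S2 = {be1 *s vec_of_C1 x + be2 *s vec_of_C1 y | x y. x \<in> S1 \<and> y \<in> S2}"

definition eigvals :: "(complex ^ 'n \<Rightarrow> complex ^ 'n) \<Rightarrow> complex set" where
  "eigvals T = {z. \<exists>v. v \<noteq> 0 \<and> T v = z *s v}"

definition eigspace :: "(complex ^ 'n \<Rightarrow> complex ^ 'n) \<Rightarrow> complex \<Rightarrow> (complex ^ 'n) set" where
  "eigspace T z = {v. T v = z *s v}"

definition modified_eigenvalue :: "(bicomplex ^ 'n \<Rightarrow> bicomplex ^ 'n) \<Rightarrow> bicomplex \<Rightarrow> bool" where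
  "modified_eigenvalue T \<kappa> \<longleftrightarrow> (\<exists>x. x \<noteq> 0 \<and> T x = \<kappa> *s x)"

definition modified_eigenspace ::
  "(bicomplex ^ 'n \<Rightarrow> bicomplex ^ 'n) \<Rightarrow> bicomplex \<Rightarrow> (bicomplex ^ 'n) set" where
  "modified_eigenspace T \<kappa> = {x. T x = \<kappa> *s x}"

end

theory Submission imports Defs begin

text \<open>The maps \<open>\<xi> \<mapsto> (\<xi>\<^sup>-, \<xi>\<^sup>+)\<close> identify the bicomplex ring with the product ring
  \<open>\<complex> \<times> \<complex>\<close>, with \<open>e\<^sub>1, e\<^sub>2\<close> becoming \<open>(1, 0)\<close> and \<open>(0, 1)\<close>. Applied componentwise they split a
  bicomplex vector into two complex ones, and \<open>T = e\<^sub>1T\<^sub>1 + e\<^sub>2T\<^sub>2\<close> acts as \<open>T\<^sub>1\<close> on the first and as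
  \<open>T\<^sub>2\<close> on the second. So \<open>T x = \<kappa>x\<close> decouples into \<open>T\<^sub>1 x\<^sup>- = \<kappa>\<^sup>- x\<^sup>-\<close> and
  \<open>T\<^sub>2 x\<^sup>+ = \<kappa>\<^sup>+ x\<^sup>+\<close>: the modified eigenspace of \<^emph>\<open>every\<close> scalar is the idempotent product of the two
  complex solution spaces (\<open>modified_eigenspace_idem_op\<close>). If \<open>\<kappa>\<^sup>-\<close> is not an eigenvalue of
  \<open>T\<^sub>1\<close>, the first of these is \<open>{0}\<close> (\<open>eigspace_eq_zero\<close>).\<close>

lemma bicomplex_eq_iff_components:
  "x = y \<longleftrightarrow> bminus x = bminus y \<and> bplus x = bplus y"
  by (metis idempotent_decomposition)

lemma bminus_hom:
  "bminus (x + y) = bminus x + bminus y" "bminus (x * y) = bminus x * bminus y"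
  by (simp_all add: bminus_def bicomplex_arith_defs algebra_simps)

lemma bplus_hom:
  "bplus (x + y) = bplus x + bplus y" "bplus (x * y) = bplus x * bplus y"
  by (simp_all add: bplus_def bicomplex_arith_defs algebra_simps)

lemma components_of_C1: "bminus (of_C1 z) = z" "bplus (of_C1 z) = z"
  by (simp_all add: bminus_def bplus_def of_C1_def)

lemma components_idempotents: "bminus be1 = 1" "bplus be1 = 0" "bminus be2 = 0" "bplus be2 = 1"
  by (simp_all add: be1_def be2_def bi1_def bi2_def bminus_def bplus_def bicomplex_arith_defs)

lemmas component_simps = bminus_hom bplus_hom components_of_C1 components_idempotents

lemma vec_eq_iff_components: "x = y \<longleftrightarrow> vminus x = vminus y \<and> vplus x = vplus y"
  by (auto simp: vec_eq_iff vminus_def vplus_def bicomplex_eq_iff_components)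

lemma vec_components_scale:
  "vminus (c *s x) = bminus c *s vminus x" "vplus (c *s x) = bplus c *s vplus x"
  by (simp_all add: vec_eq_iff vminus_def vplus_def component_simps)

lemma vec_components_idem_sum:
  "vminus (be1 *s vec_of_C1 u + be2 *s vec_of_C1 v) = u"
  "vplus (be1 *s vec_of_C1 u + be2 *s vec_of_C1 v) = v"
  by (simp_all add: vec_eq_iff vminus_def vplus_def vec_of_C1_def component_simps)

text \<open>Membership in an idempotent product is a condition on the two components separately, since
  these are the only possible coefficients of \<open>e\<^sub>1\<close> and \<open>e\<^sub>2\<close>.\<close>

lemma mem_idem_prod_iff: "x \<in> S1 \<times>\<^sub>e S2 \<longleftrightarrow> vminus x \<in> S1 \<and> vplus x \<in> S2"
proof
  assume "x \<in> S1 \<times>\<^sub>e S2"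
  then show "vminus x \<in> S1 \<and> vplus x \<in> S2"
    by (auto simp: idem_prod_def vec_components_idem_sum)
next
  assume "vminus x \<in> S1 \<and> vplus x \<in> S2"
  moreover have "x = be1 *s vec_of_C1 (vminus x) + be2 *s vec_of_C1 (vplus x)"
    by (simp add: vec_eq_iff_components vec_components_idem_sum)
  ultimately show "x \<in> S1 \<times>\<^sub>e S2"
    unfolding idem_prod_def by blast
qed

text \<open>Comparing components turns the bicomplex eigenvector equation into two independent complex
  ones; a factor is \<open>{0}\<close> when the corresponding complex equation has only the zero solution.\<close>

lemma modified_eigenspace_idem_op:
  "modified_eigenspace (idem_op T1 T2) \<kappa> =
    eigspace T1 (bminus \<kappa>) \<times>\<^sub>e eigspace T2 (bplus \<kappa>)"
proof (rule set_eqI)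
  fix x
  have "idem_op T1 T2 x = \<kappa> *s x \<longleftrightarrow>
      T1 (vminus x) = bminus \<kappa> *s vminus x \<and> T2 (vplus x) = bplus \<kappa> *s vplus x"
    by (simp add: vec_eq_iff_components idem_op_def vec_components_idem_sum vec_components_scale)
  then show "x \<in> modified_eigenspace (idem_op T1 T2) \<kappa> \<longleftrightarrow>
      x \<in> eigspace T1 (bminus \<kappa>) \<times>\<^sub>e eigspace T2 (bplus \<kappa>)"
    by (simp add: modified_eigenspace_def mem_idem_prod_iff eigspace_def)
qed

text \<open>A nonzero solution would make \<open>z\<close> an eigenvalue, and linearity gives \<open>T 0 = 0\<close>, which puts \<open>0\<close>
  in the solution space.\<close>

lemma eigspace_eq_zero:
  assumes "T \<in> L1" and "z \<notin> eigvals T"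
  shows "eigspace T z = {0}"
proof -
  have "T 0 = 0"
    using assms(1) by (simp add: L1_def Vector_Spaces.linear_iff_module_hom module_hom.zero)
  then show ?thesis
    using assms(2) by (auto simp: eigspace_def eigvals_def)
qed

theorem theorem3p16:
  fixes T1 T2 :: "complex ^ 'n \<Rightarrow> complex ^ 'n"
    and T :: "bicomplex ^ 'n \<Rightarrow> bicomplex ^ 'n"
    and \<Upsilon>1 \<Upsilon>2 :: "complex set"
    and \<kappa> :: bicomplex and \<kappa>1 \<kappa>2 :: complex
  assumes "T1 \<in> L1" and "T2 \<in> L1" and "T = idem_op T1 T2"
    and "\<Upsilon>1 = eigvals T1" and "\<Upsilon>2 = eigvals T2"
    and "\<kappa> = of_C1 \<kappa>1 * be1 + of_C1 \<kappa>2 * be2"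
    and "modified_eigenvalue T \<kappa>"
    and "\<kappa>1 \<notin> \<Upsilon>1" and "\<kappa>2 \<in> \<Upsilon>2"
  shows "modified_eigenspace T \<kappa> = {0} \<times>\<^sub>e eigspace T2 \<kappa>2"
  using assms modified_eigenspace_idem_op[of T1 T2 \<kappa>] eigspace_eq_zero[of T1 \<kappa>1]
  by (simp add: idempotent_components)

end
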